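(* Let $n\ge2$, $s\in(0,1)$, $\varepsilon>0$, let $\Omega\subset\mathbf R^n$ be a smooth bounded domain, and let $u\in H^s_{\varepsilon,\Omega}$. Then: (1) $u\in L^2_{\rm loc}(\mathbf R^n)$; (2) if $\mathcal N_su=0$ on $\mathbf R^n\setminus\bar\Omega$, then $$\int_{\mathbf R^n}\frac{|u(x)|}{1+|x|^{n+2s}}dx<+\infty.$$
   Context: Write $\Omega^c=\mathbf R^n\setminus\Omega$. Let $C_{n,s}>0$ be the usual normalization constant in the fractional Laplacian $(-\Delta)^su(x)=C_{n,s}\,\mathrm{P.V.}\int_{\mathbf R^n}\frac{u(x)-u(y)}{|x-y|^{n+2s}}dy$. The nonlocal Neumann operator is $\mathcal N_su(x)=C_{n,s}\int_\Omega\frac{u(x)-u(y)}{|x-y|^{n+2s}}dy$ for $x\in\mathbf R^n\setminus\bar\Omega$. For $\varepsilon>0$, $H^s_{\varepsilon,\Omega}$ is the space of measurable functions $u:\mathbf R^n\to\mathbf R$ (functions equal a.e. are identified) such that $$\|u\|_{H^s_{\varepsilon,\Omega}}^2=\frac{C_{n,s}\varepsilon^{2s}}{2}\int_{\mathbf R^{2n}\setminus(\Omega^c)^2}\frac{|u(x)-u(y)|^2}{|x-y|^{n+2s}}dxdy+\int_\Omega u^2dx<\infty.$$ *)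

theory Defs
  imports "HOL-Analysis.Analysis"
begin

primrec Ck_on :: "nat \<Rightarrow> 'a::real_normed_vector set \<Rightarrow> ('a \<Rightarrow> 'b::real_normed_vector) \<Rightarrow> bool" where
  "Ck_on 0 S f \<longleftrightarrow> continuous_on S f"
| "Ck_on (Suc k) S f \<longleftrightarrow> (\<forall>x\<in>S. f differentiable (at x)) \<and>
     (\<forall>v. Ck_on k S (\<lambda>x. frechet_derivative f (at x) v))"

definition smooth_on :: "'a::real_normed_vector set \<Rightarrow> ('a \<Rightarrow> 'b::real_normed_vector) \<Rightarrow> bool" where
  "smooth_on S f \<longleftrightarrow> (\<forall>k. Ck_on k S f)"

text \<open>Locally, after a rigid change of coordinates, \<open>\<Omega>\<close> is the region above a smooth graph over
  the hyperplane orthogonal to the unit vector \<open>\<nu>\<close>. Only the values of \<open>\<gamma>\<close> on that hyperplane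
  matter; a smooth function on the hyperplane extends smoothly to the whole space by composing it
  with the orthogonal projection.\<close>

definition smooth_boundary :: "'a::euclidean_space set \<Rightarrow> bool" where
  "smooth_boundary \<Omega> \<longleftrightarrow> (\<forall>p\<in>frontier \<Omega>. \<exists>r>0. \<exists>\<nu>. \<exists>\<gamma>::'a \<Rightarrow> real.
     norm \<nu> = 1 \<and> smooth_on UNIV \<gamma> \<and>
     \<Omega> \<inter> ball p r = {x \<in> ball p r. x \<bullet> \<nu> > \<gamma> (x - (x \<bullet> \<nu>) *\<^sub>R \<nu>)})"

definition smooth_bounded_domain :: "'a::euclidean_space set \<Rightarrow> bool" where
  "smooth_bounded_domain \<Omega> \<longleftrightarrow>
     \<Omega> \<noteq> {} \<and> open \<Omega> \<and> connected \<Omega> \<and> bounded \<Omega> \<and> smooth_boundary \<Omega>"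

text \<open>The standard closed form of the constant for which \<open>(-\<Delta>)\<^sup>s\<close> has Fourier symbol
  \<open>\<bar>\<xi>\<bar>\<^bsup>2s\<^esup>\<close>, for \<open>0 < s < 1\<close>.\<close>

definition frac_laplace_const :: "nat \<Rightarrow> real \<Rightarrow> real" where
  "frac_laplace_const n s =
     4 powr s * Gamma (real n / 2 + s) / (pi powr (real n / 2) * \<bar>Gamma (- s)\<bar>)"

text \<open>If \<open>u\<close> is integrable on a bounded \<open>\<Omega>\<close> (in particular if \<open>u\<close> is in the energy space below),
  the integrand is integrable for every \<open>x\<close> outside the closure of \<open>\<Omega>\<close>, so the convention that
  a divergent Bochner integral is 0 plays no role there.\<close>

definition nonlocal_neumann :: "real \<Rightarrow> 'a::euclidean_space set \<Rightarrow> ('a \<Rightarrow> real) \<Rightarrow> 'a \<Rightarrow> real" where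
  "nonlocal_neumann s \<Omega> u x = frac_laplace_const DIM('a) s *
     (LINT y:\<Omega>|lebesgue. (u x - u y) / norm (x - y) powr (real DIM('a) + 2 * s))"

definition Hs_normsq :: "real \<Rightarrow> real \<Rightarrow> 'a::euclidean_space set \<Rightarrow> ('a \<Rightarrow> real) \<Rightarrow> ennreal" where
  "Hs_normsq s \<epsilon> \<Omega> u =
     ennreal (frac_laplace_const DIM('a) s * \<epsilon> powr (2 * s) / 2) *
       (\<integral>\<^sup>+(x, y)\<in>UNIV - (- \<Omega>) \<times> (- \<Omega>).
          ennreal (\<bar>u x - u y\<bar>\<^sup>2 / norm (x - y) powr (real DIM('a) + 2 * s)) \<partial>lebesgue) +
     (\<integral>\<^sup>+x\<in>\<Omega>. ennreal ((u x)\<^sup>2) \<partial>lebesgue)"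

text \<open>The elements are representatives of the a.e.-classes.\<close>

definition Hs_space :: "real \<Rightarrow> real \<Rightarrow> 'a::euclidean_space set \<Rightarrow> ('a \<Rightarrow> real) set" where
  "Hs_space s \<epsilon> \<Omega> = {u \<in> borel_measurable lebesgue. Hs_normsq s \<epsilon> \<Omega> u < \<infinity>}"

definition L2_loc :: "('a::euclidean_space \<Rightarrow> real) set" where
  "L2_loc = {u \<in> borel_measurable lebesgue.
     \<forall>K. compact K \<longrightarrow> set_integrable lebesgue K (\<lambda>x. (u x)\<^sup>2)}"

end

theory Submission
  imports Defs
begin

text \<open>Let \<open>p = n + 2s\<close>. By Fubini, finite energy forces
  \<open>\<integral> \<bar>u x - u y\<bar>\<^sup>2 / \<bar>x - y\<bar>\<^sup>p dy < \<infinity>\<close> for some single point \<open>x \<in> \<Omega>\<close>. Since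
  \<open>1 / (1 + \<bar>y\<bar>\<^sup>p) \<le> C / \<bar>x - y\<bar>\<^sup>p\<close> and \<open>1 / (1 + \<bar>y\<bar>\<^sup>p)\<close> is integrable, \<open>u\<^sup>2\<close> is integrable
  against the weight \<open>1 / (1 + \<bar>y\<bar>\<^sup>p)\<close>. The weight is bounded below on compact sets, which gives
  the first claim, and \<open>\<bar>u\<bar> \<le> 1 + u\<^sup>2\<close> gives the second.\<close>

lemma nn_integral_inverse_norm_powr_finite:
  fixes p :: real
  assumes p: "p > DIM('a)"
  shows "(\<integral>\<^sup>+x. ennreal (1 / (1 + norm (x::'a::euclidean_space) powr p)) \<partial>lborel) < \<infinity>"
proof -
  \<comment> \<open>Dominate the weight by a sum of constants on dyadic balls.\<close>
  define g where "g k x = ennreal (2 powr (- (real k * p))) * indicator (cball 0 (2 ^ Suc k)) x"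
    for k :: nat and x :: 'a
  have g_measurable: "g k \<in> borel_measurable lborel" for k
    unfolding g_def[abs_def]
    by (intro borel_measurable_times_ennreal borel_measurable_const borel_measurable_indicator) simp
  \<comment> \<open>Ratio of the geometric series below: raising k by one multiplies the ball volume
    by 2^n and the height of \<open>g k\<close> by 2^(-p). It is less than 1 because p exceeds the
    dimension n.\<close>
  define q where "q = 2 powr (real DIM('a) - p)"
  have q: "0 \<le> q" "q < 1"
    using p powr_less_mono[of "real DIM('a) - p" 0 2] by (simp_all add: q_def)
  have bound: "ennreal (1 / (1 + norm x powr p)) \<le> (\<Sum>k. g k x)" for x :: 'a
  proof -
    \<comment> \<open>A single term of the series suffices, since all are nonnegative: k indexes the
      shell 2^k < |x| \<le> 2^(k+1), except that k = 0 takes the whole ball of radius 2.\<close>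
    have "\<exists>k. norm x \<le> 2 ^ Suc k \<and> 1 / (1 + norm x powr p) \<le> 2 powr (- (real k * p))"
    proof (cases "norm x \<le> 2")
      case True
      have "1 / (1 + norm x powr p) \<le> 1"
        by (simp add: divide_le_eq add_pos_nonneg)
      with True show ?thesis by (intro exI[of _ 0]) simp
    next
      case False
      obtain m where "norm x < 2 ^ m"
        using real_arch_pow[of 2 "norm x"] by auto
      \<comment> \<open>Minimality supplies the lower bound |x| > 2^(m-1), from which the decay of
        the weight follows.\<close>
      define m where "m = (LEAST m. norm x \<le> 2 ^ m)"
      have m: "norm x \<le> 2 ^ m"
        unfolding m_def by (rule LeastI_ex) (use \<open>norm x < 2 ^ _\<close> less_imp_le in blast)
      obtain k where k: "m = Suc k" "k > 0"
        using m False by (cases m; cases "m - 1") auto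
      have "\<not> norm x \<le> 2 ^ k"
        using not_less_Least[of k "\<lambda>m. norm x \<le> 2 ^ m"] k by (simp add: m_def)
      then have *: "2 powr real k \<le> norm x" by (simp add: powr_realpow)
      have "2 powr (real k * p) = (2 powr real k) powr p" by (simp add: powr_powr)
      also have "\<dots> \<le> norm x powr p" using * p by (intro powr_mono2) auto
      finally have "1 / (1 + norm x powr p) \<le> 1 / 2 powr (real k * p)"
        by (intro divide_left_mono mult_pos_pos add_pos_nonneg) auto
      with m k show ?thesis
        by (intro exI[of _ k]) (simp add: powr_minus_divide)
    qed
    then obtain k where k: "norm x \<le> 2 ^ Suc k"
        "1 / (1 + norm x powr p) \<le> 2 powr (- (real k * p))" by blast
    have "ennreal (1 / (1 + norm x powr p)) \<le> g k x"
      using k by (auto simp: g_def intro!: ennreal_leI)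
    also have "\<dots> \<le> (\<Sum>k. g k x)"
      using sum_le_suminf[of "\<lambda>k. g k x" "{k}"] by simp
    finally show ?thesis .
  qed
  \<comment> \<open>The part of the volume of the ball of radius 2^(k+1) that does not depend on k;
    the \<open>Suc\<close> contributes the factor 2^n.\<close>
  define c where "c = unit_ball_vol (real DIM('a)) * 2 ^ DIM('a)"
  have g_integral: "(\<integral>\<^sup>+x. g k x \<partial>lborel) = ennreal (c * q ^ k)" for k
  proof -
    have "(2 ^ Suc k :: real) ^ DIM('a) = 2 ^ DIM('a) * 2 powr (real k * real DIM('a))"
      by (simp add: power_mult_distrib powr_realpow flip: power_mult of_nat_mult)
    moreover have "2 powr (real k * real DIM('a)) * 2 powr (- (real k * p)) = q ^ k"
      by (simp add: q_def powr_powr algebra_simps flip: powr_add powr_realpow)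
    ultimately have "2 powr (- (real k * p)) * (unit_ball_vol (real DIM('a)) * (2 ^ Suc k) ^ DIM('a)) = c * q ^ k"
      by (simp add: c_def mult_ac)
    then show ?thesis
      by (simp add: g_def nn_integral_cmult_indicator emeasure_cball flip: ennreal_mult')
  qed
  have "(\<integral>\<^sup>+x. ennreal (1 / (1 + norm (x::'a) powr p)) \<partial>lborel) \<le> (\<integral>\<^sup>+x. (\<Sum>k. g k x) \<partial>lborel)"
    by (intro nn_integral_mono bound)
  also have "\<dots> = (\<Sum>k. ennreal (c * q ^ k))"
    by (subst nn_integral_suminf) (simp_all only: g_integral g_measurable)
  also have "\<dots> = ennreal (\<Sum>k. c * q ^ k)"
    using q by (intro suminf_ennreal2) (simp_all add: c_def summable_mult summable_geometric)
  finally show ?thesis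
    by (rule order_le_less_trans) simp
qed

text \<open>\<open>Gamma\<close> takes the value 0 only at its poles, the nonpositive integers, and
  -s lies strictly between -1 and 0. Positivity matters because 0 * \<infinity> = 0: with a zero
  factor, a finite norm would say nothing about the double integral.\<close>

lemma frac_laplace_const_pos:
  assumes "0 < s" "s < 1"
  shows "frac_laplace_const n s > 0"
proof -
  have "- s \<notin> \<int>\<^sub>\<le>\<^sub>0"
  proof
    assume "- s \<in> \<int>\<^sub>\<le>\<^sub>0"
    then obtain m where "- s = real_of_int m" by (auto elim!: nonpos_Ints_cases)
    with assms have "- 1 < m" "m < 0" by linarith+
    then show False by simp
  qed
  then show ?thesis
    using assms by (simp add: frac_laplace_const_def Gamma_eq_zero_iff Gamma_real_pos)
qed

lemma Hs_space_energy_at_point: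
  fixes \<Omega> :: "'a::euclidean_space set"
  assumes s: "0 < s" "s < 1" and "\<epsilon> > 0" and \<Omega>: "open \<Omega>" "\<Omega> \<noteq> {}"
    and u: "u \<in> Hs_space s \<epsilon> \<Omega>"
  obtains x where "x \<in> \<Omega>"
    "(\<integral>\<^sup>+y. ennreal (\<bar>u x - u y\<bar>\<^sup>2 / norm (x - y) powr (real DIM('a) + 2 * s)) \<partial>lebesgue) < \<infinity>"
proof -
  define p where "p = real DIM('a) + 2 * s"
  define E where "E w x y = ennreal (\<bar>w x - w y\<bar>\<^sup>2 / norm (x - y) powr p)"
    for w :: "'a \<Rightarrow> real" and x y
  have [measurable]: "\<Omega> \<in> sets borel" using \<Omega> by simp
  have "u \<in> borel_measurable lebesgue" using u by (simp add: Hs_space_def)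
  then obtain v where v [measurable]: "v \<in> borel_measurable lborel" and uv: "AE x in lborel. u x = v x"
    using completion_ex_borel_measurable_real by metis
  obtain N where "\<And>x. x \<in> space lborel - N \<Longrightarrow> u x = v x" and null: "N \<in> null_sets lborel"
    using AE_E3[OF uv] by metis
  then have N: "u x = v x" if "x \<notin> N" for x using that by simp
  have [measurable]: "N \<in> sets borel" using null by auto
  \<comment> \<open>Cutting off \<open>N\<close> in both variables makes \<open>?G\<close> a pointwise lower bound of the energy density
    that is Borel, so that Fubini applies although \<open>u\<close> is only Lebesgue measurable.\<close>
  let ?G = "\<lambda>x y. E v x y * indicator (- N) y * indicator (\<Omega> - N) x"
  have meas: "(\<lambda>z. ?G (fst z) (snd z)) \<in> borel_measurable (lborel \<Otimes>\<^sub>M lborel)"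
    unfolding E_def by measurable
  have "(\<integral>\<^sup>+x. \<integral>\<^sup>+y. ?G x y \<partial>lborel \<partial>lborel) = (\<integral>\<^sup>+z. ?G (fst z) (snd z) \<partial>lborel)"
    using lborel.nn_integral_fst[OF meas] by (simp add: lborel_prod)
  also have "\<dots> = (\<integral>\<^sup>+z. ?G (fst z) (snd z) \<partial>lebesgue)"
    by (simp add: nn_integral_completion)
  \<comment> \<open>The domain of the energy contains \<Omega> times the whole space, so y is
    unrestricted once x lies in \<Omega>.\<close>
  also have "\<dots> \<le> (\<integral>\<^sup>+(x, y)\<in>UNIV - (- \<Omega>) \<times> (- \<Omega>). E u x y \<partial>lebesgue)"
    using N by (intro nn_integral_mono) (auto simp: E_def indicator_def)
  also have "\<dots> < \<infinity>"
  proof -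
    have "frac_laplace_const DIM('a) s * \<epsilon> powr (2 * s) / 2 > 0"
      using frac_laplace_const_pos[OF s] \<open>\<epsilon> > 0\<close> by simp
    then show ?thesis
      using u by (auto simp: Hs_space_def Hs_normsq_def E_def p_def ennreal_mult_less_top
          less_top[symmetric] ennreal_mult_eq_top_iff)
  qed
  finally have fin: "(\<integral>\<^sup>+x. \<integral>\<^sup>+y. ?G x y \<partial>lborel \<partial>lborel) \<noteq> \<infinity>" by simp
  have "AE x in lborel. (\<integral>\<^sup>+y. ?G x y \<partial>lborel) \<noteq> \<infinity>"
    by (intro nn_integral_PInf_AE fin) (unfold E_def, measurable)
  moreover have "AE x in lborel. x \<notin> N" by (rule AE_not_in[OF null])
  ultimately have AE: "AE x in lborel. x \<notin> N \<and> (\<integral>\<^sup>+y. ?G x y \<partial>lborel) \<noteq> \<infinity>"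
    by eventually_elim blast
  \<comment> \<open>Almost every point is good, and a nonempty open set is not null, so \<Omega>
    contains a good point.\<close>
  obtain x where x: "x \<in> \<Omega>" "x \<notin> N" "(\<integral>\<^sup>+y. ?G x y \<partial>lborel) \<noteq> \<infinity>"
  proof (rule ccontr)
    assume "\<not> thesis"
    with that have *: "x \<notin> N \<and> (\<integral>\<^sup>+y. ?G x y \<partial>lborel) \<noteq> \<infinity> \<Longrightarrow> x \<notin> \<Omega>" for x
      by blast
    have "AE x in lborel. x \<notin> \<Omega>" by (rule eventually_mono[OF AE *])
    then have "\<Omega> \<in> null_sets lborel" by (subst AE_iff_null_sets) auto
    then have "negligible \<Omega>"
      by (simp add: negligible_iff_null_sets null_sets_completionI)
    with \<Omega> show False by (simp add: open_not_negligible)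
  qed
  \<comment> \<open>\<open>E u x\<close> need not be Borel, but passing to the completion leaves
    \<open>nn_integral\<close> of any function unchanged. As x avoids \<open>N\<close>, replacing u
    by v alters the integrand only for y in \<open>N\<close>.\<close>
  have "(\<integral>\<^sup>+y. E u x y \<partial>lebesgue) = (\<integral>\<^sup>+y. E u x y \<partial>lborel)"
    by (simp add: nn_integral_completion)
  also have "\<dots> = (\<integral>\<^sup>+y. ?G x y \<partial>lborel)"
    using AE_not_in[OF null]
  proof (intro nn_integral_cong_AE, eventually_elim)
    case (elim y)
    with x N show ?case by (auto simp: E_def)
  qed
  finally show ?thesis
    using x that[of x] by (simp add: E_def p_def less_top)
qed

text \<open>The distance is at most twice the larger norm, whose power is a summand of the expanded
  product. Separating the variables lets the kernel centred at a fixed x dominate a weight centred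
  at the origin.\<close>

lemma weight_shift_le:
  fixes x y :: "'a::real_normed_vector" and p :: real
  assumes "p \<ge> 0"
  shows "norm (x - y) powr p \<le> 2 powr p * (1 + norm x powr p) * (1 + norm y powr p)"
proof -
  let ?m = "max (norm x) (norm y)"
  have "norm (x - y) \<le> 2 * ?m"
    using norm_triangle_ineq4[of x y] by linarith
  then have "norm (x - y) powr p \<le> (2 * ?m) powr p"
    using assms by (intro powr_mono2) auto
  also have "\<dots> = 2 powr p * ?m powr p" by (simp add: powr_mult)
  also have "?m powr p \<le> (1 + norm x powr p) * (1 + norm y powr p)"
    by (auto simp: max_def algebra_simps add_increasing)
  finally show ?thesis by (simp add: mult.assoc)
qed

theorem theorem1p4:
  fixes \<Omega> :: "(real ^ 'n) set" and u :: "real ^ 'n \<Rightarrow> real" and s \<epsilon> :: real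
  assumes "CARD('n) \<ge> 2"
    and "0 < s" and "s < 1"
    and "\<epsilon> > 0"
    and "smooth_bounded_domain \<Omega>"
    and "u \<in> Hs_space s \<epsilon> \<Omega>"
  shows "u \<in> L2_loc \<and>
    ((AE x in lebesgue. x \<notin> closure \<Omega> \<longrightarrow> nonlocal_neumann s \<Omega> u x = 0) \<longrightarrow>
      (\<integral>\<^sup>+x. ennreal (\<bar>u x\<bar> / (1 + norm x powr (real CARD('n) + 2 * s))) \<partial>lebesgue) < \<infinity>)"
proof -
  define p where "p = real CARD('n) + 2 * s"
  \<comment> \<open>The surplus 2s > 0 over the dimension makes the weight \<open>w\<close>
    integrable.\<close>
  have p: "p > DIM(real ^ 'n)" using assms by (simp add: p_def)
  have u [measurable]: "u \<in> borel_measurable lebesgue" using assms by (simp add: Hs_space_def)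
  define w where "w y = 1 / (1 + norm y powr p)" for y :: "real ^ 'n"
  have [measurable]: "w \<in> borel_measurable lebesgue"
    unfolding w_def by (intro measurable_completion) measurable
  have w: "(\<integral>\<^sup>+y. ennreal (w y) \<partial>lebesgue) < \<infinity>"
    unfolding w_def nn_integral_completion by (rule nn_integral_inverse_norm_powr_finite[OF p])
  have w_pos: "w y > 0" for y by (simp add: w_def add_pos_nonneg)
  have "open \<Omega>" "\<Omega> \<noteq> {}" using assms by (auto simp: smooth_bounded_domain_def)
  then obtain x where x: "(\<integral>\<^sup>+y. ennreal (\<bar>u x - u y\<bar>\<^sup>2 / norm (x - y) powr p) \<partial>lebesgue) < \<infinity>"
    using Hs_space_energy_at_point[of s \<epsilon> \<Omega> u] assms by (auto simp: p_def)
  define C where "C = 2 powr p * (1 + norm x powr p)"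
  have C: "C \<ge> 0" by (simp add: C_def)
  have key: "(u x - u y)\<^sup>2 * w y \<le> C * (\<bar>u x - u y\<bar>\<^sup>2 / norm (x - y) powr p)" for y
  \<comment> \<open>On the diagonal both sides are 0, the right one because the numerator
    vanishes.\<close>
  proof (cases "x = y")
    case False
    have "norm (x - y) powr p * w y \<le> C"
      using weight_shift_le[of p x y] p unfolding w_def C_def
      by (simp add: divide_le_eq add_pos_nonneg)
    then have "w y \<le> C / norm (x - y) powr p"
      using False by (simp add: le_divide_eq mult.commute)
    then show ?thesis
      using mult_left_mono[of "w y" "C / norm (x - y) powr p" "(u x - u y)\<^sup>2"] by (simp add: mult_ac)
  qed simp
  have diff: "integrable lebesgue (\<lambda>y. (u x - u y)\<^sup>2 * w y)"
  proof (rule integrableI_bounded)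
    have "(\<integral>\<^sup>+y. ennreal (norm ((u x - u y)\<^sup>2 * w y)) \<partial>lebesgue)
        \<le> (\<integral>\<^sup>+y. ennreal C * ennreal (\<bar>u x - u y\<bar>\<^sup>2 / norm (x - y) powr p) \<partial>lebesgue)"
      using key C w_pos
      by (intro nn_integral_mono) (auto simp: abs_mult less_imp_le intro!: ennreal_leI simp flip: ennreal_mult)
    also have "\<dots> = ennreal C * (\<integral>\<^sup>+y. ennreal (\<bar>u x - u y\<bar>\<^sup>2 / norm (x - y) powr p) \<partial>lebesgue)"
      by (intro nn_integral_cmult) (measurable; intro measurable_completion; measurable)
    also have "\<dots> < \<infinity>" using x by (simp add: ennreal_mult_less_top)
    finally show "(\<integral>\<^sup>+y. ennreal (norm ((u x - u y)\<^sup>2 * w y)) \<partial>lebesgue) < \<infinity>" .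
  qed measurable
  have wint: "integrable lebesgue w"
    using w w_pos by (intro integrableI_bounded) (auto simp: less_imp_le)
  have sq: "integrable lebesgue (\<lambda>y. (u y)\<^sup>2 * w y)"
  proof (rule Bochner_Integration.integrable_bound)
    show "integrable lebesgue (\<lambda>y. 2 * (u x)\<^sup>2 * w y + 2 * ((u x - u y)\<^sup>2 * w y))"
      using wint diff by auto
    \<comment> \<open>With a = u x and b = u y, the bound b^2 \<le> 2a^2 + 2(a-b)^2 is equivalent to
      (2a-b)^2 \<ge> 0. Here a is a constant, so its term is integrable along with
      \<open>w\<close>.\<close>
    have "(u y)\<^sup>2 * w y \<le> (2 * (u x)\<^sup>2 + 2 * (u x - u y)\<^sup>2) * w y" for y
      using w_pos[of y] sum_squares_ge_zero[of "2 * u x - u y" 0]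
      by (intro mult_right_mono) (auto simp: power2_eq_square algebra_simps)
    then show "AE y in lebesgue. norm ((u y)\<^sup>2 * w y)
        \<le> norm (2 * (u x)\<^sup>2 * w y + 2 * ((u x - u y)\<^sup>2 * w y))"
      using w_pos by (intro AE_I2) (simp add: abs_mult less_imp_le algebra_simps)
  qed measurable
  have "u \<in> L2_loc"
    unfolding L2_loc_def
  proof (intro CollectI conjI u allI impI)
    fix K :: "(real ^ 'n) set"
    assume K: "compact K"
    then obtain B where B: "\<And>y. y \<in> K \<Longrightarrow> norm y \<le> B"
      using compact_imp_bounded bounded_iff by metis
    have [measurable]: "K \<in> sets lebesgue" using K by (simp add: compact_imp_closed)
    show "set_integrable lebesgue K (\<lambda>y. (u y)\<^sup>2)"
      unfolding set_integrable_def
    proof (rule Bochner_Integration.integrable_bound)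
      show "integrable lebesgue (\<lambda>y. (1 + B powr p) * ((u y)\<^sup>2 * w y))" using sq by simp
      have "(u y)\<^sup>2 \<le> (1 + B powr p) * ((u y)\<^sup>2 * w y)" if "y \<in> K" for y
      proof -
        have "norm y powr p \<le> B powr p" using B[OF that] p by (intro powr_mono2) auto
        then have "1 \<le> (1 + B powr p) * w y"
          by (simp add: w_def le_divide_eq add_pos_nonneg)
        from mult_left_mono[OF this, of "(u y)\<^sup>2"] show ?thesis by (simp add: mult_ac)
      qed
      then show "AE y in lebesgue. norm (indicat_real K y *\<^sub>R (u y)\<^sup>2)
          \<le> norm ((1 + B powr p) * ((u y)\<^sup>2 * w y))"
        using w_pos by (intro AE_I2) (auto simp: indicator_def abs_mult less_imp_le)
    qed measurable
  qed
  moreover have "(\<integral>\<^sup>+y. ennreal (\<bar>u y\<bar> / (1 + norm y powr p)) \<partial>lebesgue) < \<infinity>"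
  proof -
    have "integrable lebesgue (\<lambda>y. u y * w y)"
    proof (rule Bochner_Integration.integrable_bound)
      show "integrable lebesgue (\<lambda>y. w y + (u y)\<^sup>2 * w y)" using wint sq by auto
      have "\<bar>u y\<bar> * w y \<le> (1 + (u y)\<^sup>2) * w y" for y
      proof (intro mult_right_mono)
        \<comment> \<open>Expanding gives 2|u y| \<le> 1 + (u y)^2, and |u y| \<le> 2|u y|.\<close>
        have "0 \<le> (\<bar>u y\<bar> - 1)\<^sup>2" by simp
        then show "\<bar>u y\<bar> \<le> 1 + (u y)\<^sup>2" unfolding power2_diff by simp
      qed (use w_pos[of y] in simp)
      then show "AE y in lebesgue. norm (u y * w y) \<le> norm (w y + (u y)\<^sup>2 * w y)"
        using w_pos by (intro AE_I2) (simp add: abs_mult less_imp_le algebra_simps)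
    qed measurable
    then show ?thesis
      using w_pos by (simp add: integrable_iff_bounded abs_mult less_imp_le w_def)
  qed
  ultimately show ?thesis by (simp add: p_def)
qed

end
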